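(* Let $a\in\mathbb{Q}$ with $a\neq -8$, and suppose that $$f(x)=(4a+32)x^5+(-5a^2+5a)x-a^3+a^2$$ is irreducible over $\mathbb{Q}$. Let $\alpha$ be a root of $f(x)$. Then the number $$\frac{1}{a^2+4a-8}\left[\frac{4a^2+16a-128}{a^2-a}\alpha^4+\frac{8a+64}{a}\alpha^3+(-2a-16)\alpha^2+(2a+4)\alpha-4a+16\right]$$ is a root of $$(a^3+7a^2-8a)x^5+(10a^2+115a-125)x+2a^2-76a-250.$$ *)

theory Defs
  imports Complex_Main "HOL-Computational_Algebra.Computational_Algebra"
begin

text \<open>Coefficients are listed from degree 0 upwards.\<close>

definition source_quintic :: "rat \<Rightarrow> rat poly" where
  "source_quintic a = [:- (a^3) + a^2, - 5 * a^2 + 5 * a, 0, 0, 0, 4 * a + 32:]"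

definition target_quintic :: "rat \<Rightarrow> rat poly" where
  "target_quintic a =
     [:2 * a^2 - 76 * a - 250, 10 * a^2 + 115 * a - 125, 0, 0, 0, a^3 + 7 * a^2 - 8 * a:]"

definition transformed_root :: "rat \<Rightarrow> complex \<Rightarrow> complex" where
  "transformed_root a \<alpha> =
     of_rat (1 / (a^2 + 4 * a - 8)) *
       (of_rat ((4 * a^2 + 16 * a - 128) / (a^2 - a)) * \<alpha>^4
        + of_rat ((8 * a + 64) / a) * \<alpha>^3
        + of_rat (- 2 * a - 16) * \<alpha>^2
        + of_rat (2 * a + 4) * \<alpha>
        + of_rat (- 4 * a + 16))"

end

theory Submission
  imports Defs
begin

text \<open>At \<open>a = 0\<close> and \<open>a = 1\<close> both lower coefficients vanish and a
  multiple of \<open>x^5\<close> remains. Excluding these values makes the denominators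
  \<open>a\<close> and \<open>a^2 - a\<close> in \<open>transformed_root\<close> nonzero.\<close>

lemma irreducible_source_quintic_nontrivial:
  assumes "irreducible (source_quintic a)"
  shows "a \<noteq> 0" and "a \<noteq> 1"
proof -
  have "\<not> irreducible [:0, 0, 0, 0, 0, c:]" for c :: rat
  proof
    assume "irreducible [:0, 0, 0, 0, 0, c:]"
    moreover have "[:0, 0, 0, 0, 0, c:] = [:0, 1:] * [:0, 0, 0, 0, c:]"
      by simp
    ultimately have "[:0, 1:] dvd (1 :: rat poly) \<or> [:0, 0, 0, 0, c:] dvd 1"
      by (metis irreducibleD)
    then show False
      by (auto simp: is_unit_poly_iff split: if_splits)
  qed
  then show "a \<noteq> 0" and "a \<noteq> 1"
    using assms by (auto simp: source_quintic_def)
qed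

text \<open>The quadratic is \<open>(a + 2)^2 - 12\<close>, and 12 is not the square of a
  rational.\<close>

lemma quadratic_denominator_nonzero:
  fixes a :: rat
  shows "a^2 + 4 * a - 8 \<noteq> 0"
proof
  assume "a^2 + 4 * a - 8 = 0"
  then have root: "poly [:-8, 4, 1:] a = 0"
    by (simp add: power2_eq_square algebra_simps)
  \<comment> \<open>The polynomial is monic over the integers, so its rational root must be an
    integer.\<close>
  have "coeff [:-8, 4, 1:] i \<in> (\<int> :: rat set)" for i
    by (auto simp: coeff_pCons split: nat.splits)
  then have "algebraic_int a"
    using root by (intro algebraic_int.intros[of "[:-8, 4, 1:]"]) auto
  moreover have "a \<in> \<rat>"
    by (simp add: Rats_def)
  ultimately obtain k where k: "a = of_int k"
    using rational_algebraic_int_is_int Ints_cases by metis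
  \<comment> \<open>Completing the square; 12 lies strictly between \<open>3^2\<close> and
    \<open>4^2\<close>.\<close>
  have "of_int ((k + 2)^2) = (of_int 12 :: rat)"
    using root by (simp add: k power2_eq_square algebra_simps)
  then have "\<bar>k + 2\<bar>^2 = 12"
    by (simp only: of_int_eq_iff power2_abs)
  moreover have "\<bar>k + 2\<bar>^2 \<le> 3^2" if "\<bar>k + 2\<bar> \<le> 3"
    using that by (intro power_mono) auto
  moreover have "4^2 \<le> \<bar>k + 2\<bar>^2" if "4 \<le> \<bar>k + 2\<bar>"
    using that by (intro power_mono) auto
  ultimately show False
    by fastforce
qed

text \<open>With the denominators of \<open>b\<close> cleared, the claim reduces to polynomial
  identities that \<open>algebra\<close> can check; the nonzero hypotheses allow the auxiliary
  factors to be cancelled afterwards.\<close>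

lemma quintic_transformation:
  fixes A x b :: "'a::field"
  assumes nz: "A \<noteq> 0" "A \<noteq> 1" "A^2 + 4 * A - 8 \<noteq> 0"
    and root: "(4 * A + 32) * x^5 + (- 5 * A^2 + 5 * A) * x + (- (A^3) + A^2) = 0"
    and b: "(A^2 + 4 * A - 8) * (A * (A - 1)) * b =
      (4 * A^2 + 16 * A - 128) * x^4 + (8 * A + 64) * (A - 1) * x^3
      + A * (A - 1) * ((- 2 * A - 16) * x^2 + (2 * A + 4) * x + (- 4 * A + 16))"
      (is "?D * _ * b = ?P")
  shows "(A^3 + 7 * A^2 - 8 * A) * b^5 + (10 * A^2 + 115 * A - 125) * b
    + (2 * A^2 - 76 * A - 250) = 0" (is "?G = 0")
proof -
  let ?f = "(4 * A + 32) * x^5 + (- 5 * A^2 + 5 * A) * x + (- (A^3) + A^2)"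
  \<comment> \<open>\<open>?S\<close> and \<open>?T\<close> are the remainders modulo \<open>?f\<close>, as polynomials in \<open>x\<close>, of the second and
    fourth powers of \<open>b\<close>, cleared of denominators; the long factors next to \<open>?f\<close> below are the
    quotients of the corresponding divisions.\<close>
  let ?S = "4 * (A + 8)^2 * x^4 - 4 * (A + 2) * (A + 8) * x^3
    + (A - 1) * (16 * (A + 5) * x^2 - 4 * A * (A + 5) * x - 4 * A * (A + 8))"
  let ?T = "(20 * A^2 + 368 * A + 800) * x^4 + (4 * A^3 - 56 * A^2 - 272 * A) * x^3
    + (8 * A^3 + 20 * A^2 + 80 * A) * x^2 + (28 * A^3 + 64 * A^2 - 200 * A) * x
    - 8 * A^4 - 80 * A^3 + 88 * A^2"
  have sq: "?D * (A * (A - 1)) * b^2 = ?S"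
  proof -
    have "?D * (A * (A - 1)) * (?D * (A * (A - 1)) * b^2) = ?P^2"
      unfolding b[symmetric] by (simp add: power2_eq_square mult_ac)
    also have "\<dots> = ?D * (A * (A - 1)) * ?S + ?f *
      ((4 * A^3 - 192 * A + 512) * x^3 + (16 * A^3 + 48 * A^2 - 576 * A + 512) * x^2
       + (- 4 * A^4 + 4 * A^3 + 240 * A^2 - 368 * A + 128) * x
       - 4 * A^4 - 60 * A^3 + 96 * A^2 - 32 * A)"
      by algebra
    also have "\<dots> = ?D * (A * (A - 1)) * ?S"
      unfolding root by simp
    finally show ?thesis
      using nz by simp
  qed
  have fourth: "?D * (A^2 * (A - 1)) * b^4 = ?T"
  proof -
    \<comment> \<open>Squaring \<open>sq\<close> produces the factor
      \<open>?D^2 * A^2 * (A - 1)^2\<close>. The remainder of \<open>?S^2\<close> is divisible by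
      \<open>?D * (A - 1)\<close>, so that much cancels.\<close>
    have "?D * (A - 1) * (?D * (A^2 * (A - 1)) * b^4) = ?S^2"
      unfolding sq[symmetric] by algebra
    also have "\<dots> = ?D * (A - 1) * ?T + ?f *
      ((4 * A^3 + 96 * A^2 + 768 * A + 2048) * x^3
       + (- 8 * A^3 - 144 * A^2 - 768 * A - 1024) * x^2
       + (36 * A^3 + 432 * A^2 + 1008 * A - 1152) * x
       - 8 * A^4 - 128 * A^3 - 408 * A^2 + 224 * A + 320)"
      by algebra
    also have "\<dots> = ?D * (A - 1) * ?T"
      unfolding root by simp
    finally show ?thesis
      using nz by simp
  qed
  \<comment> \<open>The leading coefficient is \<open>A * (A - 1) * (A + 8)\<close>. Writing
    \<open>b^5\<close> as \<open>b^4 * b\<close>, this multiplier supplies exactly the factors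
    needed to apply \<open>fourth\<close> and \<open>b\<close>.\<close>
  have "?D^2 * A^2 * (A - 1) * ?G =
      (A + 8) * (?D * (A^2 * (A - 1)) * b^4) * (?D * (A * (A - 1)) * b)
      + (10 * A^2 + 115 * A - 125) * ?D * A * (?D * (A * (A - 1)) * b)
      + (2 * A^2 - 76 * A - 250) * ?D^2 * A^2 * (A - 1)"
    by algebra
  also have "\<dots> = (A + 8) * ?T * ?P + (10 * A^2 + 115 * A - 125) * ?D * A * ?P
      + (2 * A^2 - 76 * A - 250) * ?D^2 * A^2 * (A - 1)"
    unfolding b fourth ..
  \<comment> \<open>Here the division by \<open>?f\<close> leaves no remainder, which is why
    \<open>b\<close> is a root.\<close>
  also have "\<dots> = ?f *
      ((20 * A^4 + 448 * A^3 + 1632 * A^2 - 8576 * A - 25600) * x^3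
       + (4 * A^5 + 392 * A^3 + 7136 * A^2 + 14016 * A - 12800) * x^2
       + (6 * A^5 - 258 * A^4 - 3096 * A^3 - 4560 * A^2 + 4992 * A) * x
       - 2 * A^6 + 68 * A^5 + 870 * A^4 + 764 * A^3 - 3104 * A^2 + 4320 * A)"
    by algebra
  also have "\<dots> = 0"
    unfolding root by simp
  finally show ?thesis
    using nz by simp
qed

theorem theorem1p3:
  fixes a :: rat and \<alpha> :: complex
  assumes "a \<noteq> -8"
    and "irreducible (source_quintic a)"
    and "poly (map_poly of_rat (source_quintic a)) \<alpha> = 0"
  shows "poly (map_poly of_rat (target_quintic a)) (transformed_root a \<alpha>) = 0"
proof -
  define A :: complex where "A = of_rat a"
  define b where "b = transformed_root a \<alpha>"
  have a: "a \<noteq> 0" "a \<noteq> 1" "a^2 + 4 * a - 8 \<noteq> 0"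
    using irreducible_source_quintic_nontrivial[OF assms(2)] quadratic_denominator_nonzero
    by auto
  have D: "of_rat (a^2 + 4 * a - 8) = A^2 + 4 * A - 8"
    by (simp add: A_def of_rat_add of_rat_diff of_rat_mult of_rat_power)
  have nz: "A \<noteq> 0" "A \<noteq> 1" "A^2 + 4 * A - 8 \<noteq> 0"
    using a unfolding D[symmetric] by (auto simp: A_def)
  have root: "(4 * A + 32) * \<alpha>^5 + (- 5 * A^2 + 5 * A) * \<alpha> + (- (A^3) + A^2) = 0"
    using assms(3)
    by (simp add: source_quintic_def map_poly_pCons A_def of_rat_add of_rat_diff of_rat_mult
        of_rat_power of_rat_minus algebra_simps eval_nat_numeral)
  have b: "b = 1 / (A^2 + 4 * A - 8) *
      ((4 * A^2 + 16 * A - 128) / (A * (A - 1)) * \<alpha>^4 + (8 * A + 64) / A * \<alpha>^3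
      + (- 2 * A - 16) * \<alpha>^2 + (2 * A + 4) * \<alpha> + (- 4 * A + 16))"
    by (simp add: b_def transformed_root_def A_def of_rat_add of_rat_diff of_rat_mult
        of_rat_divide of_rat_power of_rat_minus power2_eq_square right_diff_distrib)
  have "(A^2 + 4 * A - 8) * (A * (A - 1)) * b =
      (4 * A^2 + 16 * A - 128) * \<alpha>^4 + (8 * A + 64) * (A - 1) * \<alpha>^3
      + A * (A - 1) * ((- 2 * A - 16) * \<alpha>^2 + (2 * A + 4) * \<alpha> + (- 4 * A + 16))"
  proof -
    \<comment> \<open>The coefficients are abstracted to \<open>u\<close>, \<open>v\<close>,
      \<open>w\<close> so that simplification clears the denominators without expanding
      them.\<close>
    have "A * (A - 1) * (u / (A * (A - 1)) * \<alpha>^4 + v / A * \<alpha>^3 + w)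
        = u * \<alpha>^4 + v * (A - 1) * \<alpha>^3 + A * (A - 1) * w" for u v w
      using nz(1,2) by (simp add: distrib_left)
    from this[of "4 * A^2 + 16 * A - 128" "8 * A + 64"
        "(- 2 * A - 16) * \<alpha>^2 + (2 * A + 4) * \<alpha> + (- 4 * A + 16)"]
    show ?thesis
      using nz(3) unfolding b by (simp add: add.assoc mult.assoc)
  qed
  from quintic_transformation[OF nz root this]
  show ?thesis
    unfolding b_def[symmetric]
    by (simp add: target_quintic_def map_poly_pCons A_def of_rat_add of_rat_diff of_rat_mult
        of_rat_power of_rat_minus algebra_simps eval_nat_numeral)
qed

end
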